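(* Let $E\subset\mathbb{R}^d$ be a nonempty closed set with $E\ne\mathbb{R}^d$, let $\mathcal{W}(\mathbb{R}^d\setminus E)$ be an arbitrary but fixed Whitney cover of $\mathbb{R}^d\setminus E$, and let $B_0$ be a closed ball centered at a point of $E$. If $k\in\mathbb{N}$ and $2^{-k-1}<r\le2^{-k}$, then $$\mathcal{H}^{d-1}(\partial E_r\cap3B_0)\ge c\,r^{d-1}\,\#\mathcal{W}_k(\mathbb{R}^d\setminus E;B_0),$$ where $c>0$ depends only on $d$.
   Context: $E_r=\{x\in\mathbb{R}^d:\operatorname{dist}(x,E)<r\}$, $\partial E_r=\{x\in\mathbb{R}^d:\operatorname{dist}(x,E)=r\}$, and $\mathcal{H}^{d-1}$ is the $(d-1)$-dimensional Hausdorff measure. Balls $B(x,R)$ are closed, and for a ball $B_0=B(x,R)$, $3B_0=B(x,3R)$. $\#$ denotes cardinality. Whitney cover: for an open set $\Omega\subsetneq\mathbb{R}^d$, a Whitney cover $\mathcal{W}(\Omega)$ is a countable collection $\{B_i\}_{i\in I}$ of closed balls $B_i=B(x_i,r_i)$ with $x_i\in\Omega$, $r_i=\frac18\operatorname{dist}(x_i,\mathbb{R}^d\setminus\Omega)$, $\Omega=\bigcup_iB_i$, and $\sum_i\chi_{B_i}\le C$ for some constant $C\ge1$, where $\chi_{B_i}$ is the characteristic function of $B_i$. For $k\in\mathbb{Z}$ and $A\subset\mathbb{R}^d$, $\mathcal{W}_k(\Omega;A)=\{B(x_i,r_i)\in\mathcal{W}(\Omega):2^{-k-1}<r_i\le2^{-k},\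 A\cap B(x_i,r_i)\neq\emptyset\}$.
   Formalization: The constant c is proved to depend on d and on the overlap constant C of the Whitney cover; with dependence on d alone the claim fails for arbitrary covers (E={0}, adding many nearly equal balls at one level). *)

theory Defs
  imports "HOL-Analysis.Analysis"
begin

text \<open>
  Hausdorff (outer) measure of natural dimension \<open>s\<close>, without a normalising constant.
  Note that \<open>0 ^ 0 = 1\<close>, so for \<open>s = 0\<close> each nonempty covering set contributes \<open>1\<close>, while
  empty sets (which allow finite covers to be written as sequences) contribute \<open>0\<close>.
  Boundedness is required because \<^const>\<open>diameter\<close> is unspecified on unbounded sets.
\<close>

definition hausdorff_content :: "nat \<Rightarrow> real \<Rightarrow> 'a::metric_space set \<Rightarrow> ennreal" where
  "hausdorff_content s \<delta> A =
     (INF U \<in> {U :: nat \<Rightarrow> 'a set. A \<subseteq> (\<Union>i. U i) \<and> (\<forall>i. bounded (U i) \<and> diameter (U i) \<le> \<delta>)}.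
        (\<Sum>i. if U i = {} then 0 else ennreal (diameter (U i) ^ s)))"

definition hausdorff_measure :: "nat \<Rightarrow> 'a::metric_space set \<Rightarrow> ennreal" where
  "hausdorff_measure s A = (SUP \<delta> \<in> {0<..}. hausdorff_content s \<delta> A)"

text \<open>
  The set written \<open>\<partial>E\<^sub>r\<close>. It is by definition the level set of the distance function, which may
  be larger than the topological frontier of the open tubular neighbourhood \<open>E\<^sub>r\<close>.
\<close>

definition tube_boundary :: "'a::metric_space set \<Rightarrow> real \<Rightarrow> 'a set" where
  "tube_boundary E r = {x. infdist x E = r}"

text \<open>
  The overlap bound \<open>C\<close> is an explicit parameter: no bound uniform over all \<open>C\<close> can hold for the
  number of balls of a given size, so constants have to be chosen after \<open>C\<close>.
\<close>

definition whitney_cover :: "real \<Rightarrow> 'a::metric_space set \<Rightarrow> 'a set set \<Rightarrow> bool" where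
  "whitney_cover C \<Omega> \<W> \<longleftrightarrow>
     open \<Omega> \<and> \<Omega> \<noteq> UNIV \<and> countable \<W> \<and>
     (\<forall>B\<in>\<W>. \<exists>x\<in>\<Omega>. B = cball x (infdist x (- \<Omega>) / 8)) \<and>
     \<Omega> = \<Union>\<W> \<and>
     (\<forall>y. (\<Sum>\<^sub>\<infinity>B\<in>\<W>. indicator B y :: ennreal) \<le> ennreal C)"

text \<open>
  In a Euclidean space of positive dimension a nonempty closed ball determines its centre and
  radius, so the existential quantifier below just recovers the radius of \<open>B\<close>.
\<close>

definition whitney_level :: "'a::metric_space set set \<Rightarrow> int \<Rightarrow> 'a set \<Rightarrow> 'a set set" where
  "whitney_level \<W> k A =
     {B \<in> \<W>. (\<exists>x \<rho>. B = cball x \<rho> \<and> 2 powi (- k - 1) < \<rho> \<and> \<rho> \<le> 2 powi (- k)) \<and> A \<inter> B \<noteq> {}}"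

text \<open>Cardinality with value \<open>\<infinity>\<close> on infinite sets, unlike \<^const>\<open>card\<close>.\<close>

definition ecard :: "'a set \<Rightarrow> ennreal" where
  "ecard S = emeasure (count_space UNIV) S"

end

theory Submission
  imports Defs
begin

text \<open>
  Let \<open>B = B(x, \<rho>)\<close> be a Whitney ball of the given level and \<open>e\<close> a point of \<open>E\<close> nearest to \<open>x\<close>.
  Translating \<open>B(e, r/2)\<close> along \<open>a = x - e\<close> carries each of its points from distance at most \<open>r\<close>
  to distance at least \<open>r\<close> from \<open>E\<close>, so each point crosses the level set on the way. Hence, if
  sets \<open>U\<^sub>i\<close> cover the level set near \<open>x\<close>, then \<open>B(e, r/2)\<close> is covered by the sets swept out by
  the \<open>U\<^sub>i\<close> along \<open>-a\<close>; these have volume at most of order \<open>r (diam U\<^sub>i)\<^bsup>d-1\<^esup>\<close>, which gives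
  \<open>\<Sum> (diam U\<^sub>i)\<^bsup>d-1\<^esup> \<ge> c r\<^bsup>d-1\<^esup>\<close>. By volume and the overlap bound, a set of diameter at most
  \<open>r\<close> is used by boundedly many \<open>B\<close>, so these estimates can be added up for any single cover of
  the level set, without measurability or disjointness arguments for the Hausdorff measure.
\<close>

section \<open>Counting balls of bounded overlap by volume\<close>

lemma sum_le_overlap_bound:
  assumes W: "whitney_cover C \<Omega> \<W>" and "finite J" "J \<subseteq> \<W>"
  shows "(\<Sum>B\<in>J. indicator B y :: ennreal) \<le> ennreal C"
proof -
  have "(\<Sum>B\<in>J. indicator B y :: ennreal) = (\<Sum>\<^sub>\<infinity>B\<in>J. indicator B y)"
    using assms by simp
  also have "\<dots> \<le> (\<Sum>\<^sub>\<infinity>B\<in>\<W>. indicator B y)"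
    using assms by (intro infsum_mono_neutral) (auto intro: nonneg_summable_on_complete)
  also have "\<dots> \<le> ennreal C"
    using W by (auto simp: whitney_cover_def)
  finally show ?thesis .
qed

text \<open>Integrate the sum of the indicators: it is at least \<open>card J\<close> times the
  volume of a ball of radius \<open>s\<close>, and the overlap bound makes it at most
  \<open>C\<close> times the volume of \<open>cball p H\<close>.\<close>

lemma card_whitney_balls_le:
  fixes \<W> :: "'a::euclidean_space set set"
  assumes W: "whitney_cover C \<Omega> \<W>" and "C \<ge> 0" and J: "finite J" "J \<subseteq> \<W>"
    and s: "s > 0" and H: "H \<ge> 0"
    and balls: "\<And>B. B \<in> J \<Longrightarrow> \<exists>x \<rho>. B = cball x \<rho> \<and> s \<le> \<rho> \<and> B \<subseteq> cball p H"
  shows "real (card J) \<le> C * (H / s) ^ DIM('a)"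
proof -
  let ?V = "unit_ball_vol (real DIM('a))"
  have V: "?V > 0" by simp
  have meas: "B \<in> sets borel" if "B \<in> J" for B
    using balls[OF that] by auto
  have "ennreal (real (card J) * (?V * s ^ DIM('a))) = (\<Sum>B\<in>J. ennreal (?V * s ^ DIM('a)))"
    using s V by (simp add: ennreal_mult ennreal_of_nat_eq_real_of_nat)
  also have "\<dots> \<le> (\<Sum>B\<in>J. emeasure lborel B)"
  proof (rule sum_mono)
    fix B assume "B \<in> J"
    then obtain x \<rho> where B: "B = cball x \<rho>" "s \<le> \<rho>" using balls by blast
    then show "ennreal (?V * s ^ DIM('a)) \<le> emeasure lborel B"
      using s V by (auto simp: emeasure_cball intro!: ennreal_leI mult_left_mono power_mono)
  qed
  also have "\<dots> = (\<Sum>B\<in>J. \<integral>\<^sup>+y. indicator B y \<partial>lborel)"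
    using meas by (intro sum.cong) auto
  also have "\<dots> = (\<integral>\<^sup>+y. (\<Sum>B\<in>J. indicator B y) \<partial>lborel)"
    using meas by (intro nn_integral_sum[symmetric]) auto
  also have "\<dots> \<le> (\<integral>\<^sup>+y. ennreal C * indicator (cball p H) y \<partial>lborel)"
  proof (rule nn_integral_mono)
    fix y :: 'a
    show "(\<Sum>B\<in>J. indicator B y) \<le> ennreal C * indicator (cball p H) y"
    proof (cases "y \<in> cball p H")
      case True
      then show ?thesis using sum_le_overlap_bound[OF W J] by simp
    next
      case False
      have "(\<Sum>B\<in>J. indicator B y :: ennreal) = 0"
        using False balls by (intro sum.neutral) (fastforce simp: indicator_def)
      then show ?thesis by simp
    qed
  qed
  also have "\<dots> = ennreal (C * (?V * H ^ DIM('a)))"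
    using H V \<open>C \<ge> 0\<close> by (simp add: nn_integral_cmult_indicator emeasure_cball ennreal_mult)
  finally have "real (card J) * (?V * s ^ DIM('a)) \<le> C * (?V * H ^ DIM('a))"
    using H V \<open>C \<ge> 0\<close> by (subst (asm) ennreal_le_iff) auto
  then have "?V * (real (card J) * s ^ DIM('a)) \<le> ?V * (C * H ^ DIM('a))"
    by (simp add: mult_ac)
  then have "real (card J) * s ^ DIM('a) \<le> C * H ^ DIM('a)"
    using V by simp
  then show ?thesis
    using s by (simp add: power_divide field_simps)
qed

section \<open>Volume swept out along a segment\<close>

text \<open>The Minkowski sum of \<open>A\<close> and the segment from \<open>-a\<close> to
  \<open>0\<close>: the points that meet \<open>A\<close> while being translated by
  \<open>a\<close>.\<close>

definition sweep :: "'a::real_vector \<Rightarrow> 'a set \<Rightarrow> 'a set" where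
  "sweep a A = (\<lambda>(t, y). y - t *\<^sub>R a) ` ({0..1} \<times> A)"

lemma sweep_mono: "A \<subseteq> B \<Longrightarrow> sweep a A \<subseteq> sweep a B"
  unfolding sweep_def by auto

lemma compact_sweep:
  fixes A :: "'a::real_normed_vector set"
  assumes "compact A"
  shows "compact (sweep a A)"
  unfolding sweep_def case_prod_beta
  by (intro compact_continuous_image compact_Times assms continuous_intros) auto

text \<open>Balls of radius \<open>2 * \<rho>\<close> with centres spaced by \<open>\<rho>\<close>
  on the segment from \<open>q\<close> to \<open>q - a\<close> cover the sweep. There are at most
  \<open>norm a / \<rho> + 1\<close> of them; this division by \<open>\<rho>\<close> is what lowers
  the exponent to the dimension minus one.\<close>

lemma emeasure_sweep_cball_le_pos:
  fixes a q :: "'a::euclidean_space"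
  assumes "\<rho> > 0"
  shows "emeasure lborel (sweep a (cball q \<rho>)) \<le>
    ennreal (unit_ball_vol (real DIM('a)) * 2 ^ DIM('a) * (norm a + \<rho>) * \<rho> ^ (DIM('a) - 1))"
proof -
  let ?V = "unit_ball_vol (real DIM('a))"
  have V: "?V > 0" by simp
  define n where "n = nat \<lfloor>norm a / \<rho>\<rfloor>"
  \<comment> \<open>If \<open>a = 0\<close>, division by zero gives \<open>0\<close> and every
    centre is \<open>q\<close>.\<close>
  define c where "c j = q - (real j * \<rho> / norm a) *\<^sub>R a" for j
  have "sweep a (cball q \<rho>) \<subseteq> (\<Union>j\<le>n. cball (c j) (2 * \<rho>))"
  proof
    fix w assume "w \<in> sweep a (cball q \<rho>)"
    then obtain t y where t: "0 \<le> t" "t \<le> 1" and y: "dist q y \<le> \<rho>" and w: "w = y - t *\<^sub>R a"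
      by (auto simp: sweep_def)
    \<comment> \<open>Index of the last centre passed by time \<open>t\<close>: the position along
      the segment is off by at most \<open>\<rho>\<close>, and \<open>y\<close> differs from
      \<open>q\<close> by at most \<open>\<rho>\<close>.\<close>
    define j where "j = nat \<lfloor>t * norm a / \<rho>\<rfloor>"
    have "t * norm a / \<rho> \<le> norm a / \<rho>"
      using t assms by (intro divide_right_mono mult_left_le_one_le) auto
    then have "j \<le> n" unfolding j_def n_def by (intro nat_mono floor_mono)
    have rj: "real j = of_int \<lfloor>t * norm a / \<rho>\<rfloor>"
      using t assms by (simp add: j_def)
    have "real j \<le> t * norm a / \<rho>" "t * norm a / \<rho> \<le> real j + 1"
      unfolding rj by linarith+
    then have j: "real j * \<rho> \<le> t * norm a" "t * norm a \<le> real j * \<rho> + \<rho>"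
      using assms by (simp_all add: field_simps)
    have "c j - w = (q - y) + (t - real j * \<rho> / norm a) *\<^sub>R a"
      by (simp add: c_def w algebra_simps)
    then have "dist (c j) w \<le> norm (q - y) + \<bar>t - real j * \<rho> / norm a\<bar> * norm a"
      unfolding dist_norm using norm_triangle_ineq by (metis norm_scaleR)
    also have "\<bar>t - real j * \<rho> / norm a\<bar> * norm a \<le> \<rho>"
    proof (cases "a = 0")
      case True then show ?thesis using assms by simp
    next
      case False
      then have "\<bar>t - real j * \<rho> / norm a\<bar> * norm a = \<bar>t * norm a - real j * \<rho>\<bar>"
        by (simp add: abs_mult_pos left_diff_distrib)
      then show ?thesis using j by simp
    qed
    finally have "dist (c j) w \<le> 2 * \<rho>" using y by (simp add: dist_norm)
    then show "w \<in> (\<Union>j\<le>n. cball (c j) (2 * \<rho>))" using \<open>j \<le> n\<close> by auto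
  qed
  then have "emeasure lborel (sweep a (cball q \<rho>)) \<le> emeasure lborel (\<Union>j\<le>n. cball (c j) (2 * \<rho>))"
    by (rule emeasure_mono) auto
  also have "\<dots> \<le> (\<Sum>j\<le>n. emeasure lborel (cball (c j) (2 * \<rho>)))"
    by (rule emeasure_subadditive_finite) auto
  also have "\<dots> = ennreal (real (n + 1) * (?V * (2 * \<rho>) ^ DIM('a)))"
    using assms V
    by (simp add: emeasure_cball ennreal_mult ennreal_of_nat_eq_real_of_nat del: of_nat_Suc of_nat_add)
  also have "\<dots> \<le> ennreal ((norm a / \<rho> + 1) * (?V * (2 * \<rho>) ^ DIM('a)))"
  proof -
    have "real n \<le> norm a / \<rho>" using assms by (simp add: n_def)
    then show ?thesis
      using assms V by (intro ennreal_leI mult_right_mono) auto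
  qed
  also have "(norm a / \<rho> + 1) * (?V * (2 * \<rho>) ^ DIM('a)) =
      ?V * 2 ^ DIM('a) * (norm a + \<rho>) * \<rho> ^ (DIM('a) - 1)"
  proof -
    have "\<rho> ^ DIM('a) = \<rho> * \<rho> ^ (DIM('a) - 1)"
      by (simp add: power_eq_if)
    then show ?thesis using assms by (simp add: power_mult_distrib field_simps)
  qed
  finally show ?thesis .
qed

text \<open>
  For \<open>\<rho> = 0\<close> the bound is \<open>0\<close> in dimension at least 2, but a multiple of \<open>norm a\<close> in dimension 1;
  passing to the limit treats both cases at once.
\<close>

lemma emeasure_sweep_cball_le:
  fixes a q :: "'a::euclidean_space"
  assumes "\<rho> \<ge> 0"
  shows "emeasure lborel (sweep a (cball q \<rho>)) \<le>
    ennreal (unit_ball_vol (real DIM('a)) * 2 ^ DIM('a) * (norm a + \<rho>) * \<rho> ^ (DIM('a) - 1))"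
    (is "_ \<le> ennreal (?f \<rho>)")
proof -
  have "((\<lambda>\<rho>. ennreal (?f \<rho>)) \<longlongrightarrow> ennreal (?f \<rho>)) (at_right \<rho>)"
    by (intro tendsto_ennrealI tendsto_intros)
  moreover have "eventually (\<lambda>\<rho>'. emeasure lborel (sweep a (cball q \<rho>)) \<le> ennreal (?f \<rho>')) (at_right \<rho>)"
    using eventually_at_right_less
  proof eventually_elim
    case (elim \<rho>')
    have "emeasure lborel (sweep a (cball q \<rho>)) \<le> emeasure lborel (sweep a (cball q \<rho>'))"
      using elim by (intro emeasure_mono sweep_mono) (auto intro!: borel_compact compact_sweep)
    also have "\<dots> \<le> ennreal (?f \<rho>')"
      using elim assms by (intro emeasure_sweep_cball_le_pos) auto
    finally show ?case .
  qed
  ultimately show ?thesis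
    by (rule tendsto_lowerbound) simp
qed

section \<open>Lower bound near a single Whitney ball\<close>

text \<open>Only sets meeting \<open>T\<close> are summed, so that later each set is charged to few
  balls. The bound \<open>3/2 * r < dist x e\<close> keeps the translate of
  \<open>cball e (r / 2)\<close> by \<open>x - e\<close> at distance at least \<open>r\<close> from
  \<open>E\<close>; on the way its points stay within \<open>dist x e + r / 2\<close> of
  \<open>x\<close>.\<close>

lemma tube_boundary_cover_local:
  fixes E :: "'a::euclidean_space set" and U :: "nat \<Rightarrow> 'a set"
  assumes e: "e \<in> E" "infdist x E = dist x e"
    and r: "r > 0" "3/2 * r < dist x e" "dist x e \<le> 16 * r"
    and T: "tube_boundary E r \<inter> cball x (dist x e + r / 2) \<subseteq> T" "T \<subseteq> (\<Union>i. U i)"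
    and U: "\<And>i. bounded (U i)" "\<And>i. diameter (U i) \<le> r"
  shows "ennreal (r ^ (DIM('a) - 1) / (17 * 4 ^ DIM('a))) \<le>
    (\<Sum>i. if U i \<inter> T = {} then 0 else ennreal (diameter (U i) ^ (DIM('a) - 1)))"
proof -
  let ?V = "unit_ball_vol (real DIM('a))"
  have V: "?V > 0" by simp
  define a where "a = x - e"
  have na: "norm a = dist x e" by (simp add: a_def dist_norm)
  \<comment> \<open>The factor \<open>17 * r\<close> bounds \<open>norm a + diameter (U i)\<close>,
    as \<open>norm a \<le> 16 * r\<close> and diameters are at most \<open>r\<close>.\<close>
  define K where "K = ?V * 2 ^ DIM('a) * (17 * r)"
  have K: "K > 0" using V r by (simp add: K_def)
  define q where "q i = (SOME p. p \<in> U i)" for i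
  \<comment> \<open>\<open>U i\<close> is arbitrary, but a closed ball containing it has a compact,
    hence Borel, sweep.\<close>
  define S where "S i = (if U i \<inter> T = {} then {} else sweep a (cball (q i) (diameter (U i))))" for i
  let ?g = "\<lambda>i. if U i \<inter> T = {} then 0 else ennreal (diameter (U i) ^ (DIM('a) - 1))"
  have cover: "cball e (r / 2) \<subseteq> (\<Union>i. S i)"
  proof
    fix w assume "w \<in> cball e (r / 2)"
    then have w: "dist e w \<le> r / 2" by simp
    let ?h = "\<lambda>t. infdist (w + t *\<^sub>R a) E"
    have "?h 0 \<le> r"
      using infdist_le[OF e(1), of w] w r by (simp add: dist_commute)
    moreover have "r \<le> ?h 1"
    proof -
      have "dist x (w + a) = dist e w"
        by (simp add: a_def dist_norm algebra_simps)
      then show ?thesis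
        using infdist_triangle[of x E "w + a"] w r e(2) by simp
    qed
    moreover have "continuous_on {0..1} ?h" by (intro continuous_intros)
    ultimately obtain t where t: "0 \<le> t" "t \<le> 1" and hit: "?h t = r"
      using IVT'[of ?h 0 r 1] by auto
    let ?y = "w + t *\<^sub>R a"
    have "x - ?y = (e - w) + (1 - t) *\<^sub>R a" by (simp add: a_def algebra_simps)
    then have "dist x ?y \<le> norm (e - w) + \<bar>1 - t\<bar> * norm a"
      unfolding dist_norm using norm_triangle_ineq by (metis norm_scaleR)
    also have "\<bar>1 - t\<bar> * norm a \<le> norm a" using t by (intro mult_left_le_one_le) auto
    finally have "dist x ?y \<le> dist x e + r / 2" using w na by (simp add: dist_norm)
    then have yT: "?y \<in> T" using hit T(1) by (auto simp: tube_boundary_def)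
    then obtain i where i: "?y \<in> U i" using T(2) by auto
    then have "q i \<in> U i" unfolding q_def by (rule someI)
    then have "?y \<in> cball (q i) (diameter (U i))"
      using diameter_bounded_bound[OF U(1) _ i] by simp
    then have "w \<in> sweep a (cball (q i) (diameter (U i)))"
      unfolding sweep_def using t by (auto intro!: image_eqI[where x = "(t, ?y)"])
    then show "w \<in> (\<Union>i. S i)" using i yT by (auto simp: S_def)
  qed
  have Smeas: "S i \<in> sets lborel" for i
    by (auto simp: S_def intro!: borel_compact compact_sweep)
  have "ennreal (?V * (r / 2) ^ DIM('a)) = emeasure lborel (cball e (r / 2))"
    using r by (simp add: emeasure_cball)
  also have "\<dots> \<le> emeasure lborel (\<Union>i. S i)"
    using cover Smeas by (intro emeasure_mono) auto
  also have "\<dots> \<le> (\<Sum>i. emeasure lborel (S i))"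
    using Smeas by (intro emeasure_subadditive_countably) auto
  also have "\<dots> \<le> (\<Sum>i. ennreal K * ?g i)"
  proof (rule suminf_le)
    fix i
    show "emeasure lborel (S i) \<le> ennreal K * ?g i"
    proof (cases "U i \<inter> T = {}")
      case False
      have D: "0 \<le> diameter (U i)" using U(1) by (rule diameter_ge_0)
      have "emeasure lborel (S i) \<le>
          ennreal (?V * 2 ^ DIM('a) * (norm a + diameter (U i)) * diameter (U i) ^ (DIM('a) - 1))"
        using False emeasure_sweep_cball_le[OF D] by (simp add: S_def)
      also have "\<dots> \<le> ennreal (K * diameter (U i) ^ (DIM('a) - 1))"
        unfolding K_def using D V U(2)[of i] r na
        by (intro ennreal_leI mult_right_mono mult_left_mono) auto
      finally show ?thesis using False K D by (simp add: ennreal_mult)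
    qed (simp add: S_def)
  qed auto
  also have "\<dots> = ennreal K * (\<Sum>i. ?g i)" by simp
  finally have main: "ennreal (?V * (r / 2) ^ DIM('a)) \<le> ennreal K * (\<Sum>i. ?g i)" .
  have "K * (r ^ (DIM('a) - 1) / (17 * 4 ^ DIM('a))) = ?V * (r / 2) ^ DIM('a)"
  proof -
    have "r ^ DIM('a) = r * r ^ (DIM('a) - 1)" by (simp add: power_eq_if)
    moreover have "(4::real) ^ DIM('a) = 2 ^ DIM('a) * 2 ^ DIM('a)"
      by (simp flip: power_mult_distrib)
    ultimately show ?thesis by (simp add: K_def power_divide)
  qed
  then have "ennreal K * ennreal (r ^ (DIM('a) - 1) / (17 * 4 ^ DIM('a))) \<le> ennreal K * (\<Sum>i. ?g i)"
    using main K r by (simp flip: ennreal_mult)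
  then show ?thesis
    using K by (simp add: ennreal_mult_le_mult_iff)
qed

section \<open>Summation over the Whitney balls\<close>

text \<open>The cover and the level each describe \<open>B\<close> as a ball. The level radius is
  positive, so both radii agree and the dyadic bounds pass to the distance from
  \<open>E\<close>.\<close>

lemma whitney_levelE:
  fixes E :: "'a::euclidean_space set"
  assumes "closed E" "E \<noteq> {}" "whitney_cover C (- E) \<W>" "B \<in> whitney_level \<W> k A"
  obtains x e where "B = cball x (dist x e / 8)" "e \<in> E" "infdist x E = dist x e"
    "2 powi (- k - 1) < dist x e / 8" "dist x e / 8 \<le> 2 powi (- k)"
proof -
  obtain x' \<rho> where x': "B = cball x' \<rho>" "2 powi (- k - 1) < \<rho>" "\<rho> \<le> 2 powi (- k)" and "B \<in> \<W>"
    using assms(4) by (auto simp: whitney_level_def)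
  then obtain x where x: "B = cball x (infdist x E / 8)"
    using assms(3) unfolding whitney_cover_def double_complement by blast
  obtain e where e: "e \<in> E" "infdist x E = dist x e"
    using infdist_attains_inf[OF assms(1,2)] by metis
  have "\<rho> > 0" using x'(2) by (meson less_trans zero_less_power_int zero_less_numeral)
  then have "\<rho> = infdist x E / 8"
    using x' x cball_eq_cball_iff[of x' \<rho> x "infdist x E / 8"] by auto
  then show ?thesis using that e x x' by simp
qed

theorem proposition5p7:
  fixes C :: real
  assumes "C \<ge> 1"
  shows "\<exists>c::real. c > 0 \<and>
    (\<forall>(E :: (real ^ 'n) set) \<W> z R (k::nat) r.
       closed E \<longrightarrow> E \<noteq> {} \<longrightarrow> E \<noteq> UNIV \<longrightarrow>
       whitney_cover C (- E) \<W> \<longrightarrow>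
       z \<in> E \<longrightarrow> R > 0 \<longrightarrow>
       2 powi (- int k - 1) < r \<longrightarrow> r \<le> 2 powi (- int k) \<longrightarrow>
       hausdorff_measure (CARD('n) - 1) (tube_boundary E r \<inter> cball z (3 * R))
         \<ge> ennreal (c * r ^ (CARD('n) - 1)) * ecard (whitney_level \<W> (int k) (cball z R)))"
proof -
  let ?d = "CARD('n)"
  have dim: "DIM(real ^ 'n) = ?d" by simp
  \<comment> \<open>\<open>N\<close> bounds how many balls use one covering set; \<open>c\<close> is
    the constant of the local estimate divided by \<open>N\<close>.\<close>
  define N where "N = C * 22 ^ ?d"
  define c where "c = 1 / (17 * 4 ^ ?d) / N"
  have N: "N > 0" using assms by (simp add: N_def)
  then have c: "c > 0" by (simp add: c_def)
  have "ennreal (c * r ^ (?d - 1)) * ecard (whitney_level \<W> (int k) (cball z R))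
      \<le> hausdorff_measure (?d - 1) (tube_boundary E r \<inter> cball z (3 * R))"
    if E: "closed E" "E \<noteq> {}" and W: "whitney_cover C (- E) \<W>" and z: "z \<in> E" and R: "R > 0"
      and r: "2 powi (- int k - 1) < r" "r \<le> 2 powi (- int k)"
    for E :: "(real ^ 'n) set" and \<W> z R r and k :: nat
  proof -
    \<comment> \<open>Unit of length: \<open>r\<close> and all Whitney radii of the level lie above
      \<open>s\<close> and at most at \<open>2 * s\<close>.\<close>
    define s :: real where "s = 2 powi (- int k - 1)"
    have s: "s > 0" by (simp add: s_def)
    have s2: "2 powi (- int k) = 2 * s" by (simp add: s_def power_int_diff)
    note r = r[folded s_def, unfolded s2]
    have r0: "r > 0" using r s by simp
    define J where "J = whitney_level \<W> (int k) (cball z R)"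
    have JW: "J \<subseteq> \<W>" by (auto simp: J_def whitney_level_def)
    have "\<forall>B\<in>J. \<exists>x e. B = cball x (dist x e / 8) \<and> e \<in> E \<and> infdist x E = dist x e \<and>
        s < dist x e / 8 \<and> dist x e / 8 \<le> 2 * s"
      unfolding J_def by (metis whitney_levelE[OF E W] s_def s2)
    then obtain x e where "\<forall>B\<in>J. B = cball (x B) (dist (x B) (e B) / 8) \<and> e B \<in> E \<and>
        infdist (x B) E = dist (x B) (e B) \<and> s < dist (x B) (e B) / 8 \<and> dist (x B) (e B) / 8 \<le> 2 * s"
      by metis
    then have ball: "B = cball (x B) (dist (x B) (e B) / 8)" and e: "e B \<in> E"
        "infdist (x B) E = dist (x B) (e B)"
      and xe: "s < dist (x B) (e B) / 8" "dist (x B) (e B) / 8 \<le> 2 * s" if "B \<in> J" for B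
      using that by blast+
    have meet: "dist z (x B) \<le> R + dist (x B) (e B) / 8" if B: "B \<in> J" for B
    proof -
      obtain y where "y \<in> cball z R" "y \<in> B"
        using B by (auto simp: J_def whitney_level_def)
      then have "dist z y \<le> R" "dist (x B) y \<le> dist (x B) (e B) / 8"
        using ball[OF B] by auto
      then show ?thesis using dist_triangle[of z "x B" y] by (simp add: dist_commute)
    qed
    define T where "T B = tube_boundary E r \<inter> cball (x B) (dist (x B) (e B) + r / 2)" for B
    have T3: "T B \<subseteq> tube_boundary E r \<inter> cball z (3 * R)" if B: "B \<in> J" for B
    proof
      fix y assume y: "y \<in> T B"
      have "dist (x B) (e B) \<le> dist (x B) z"
        using infdist_le[OF z, of "x B"] e(2)[OF B] by simp
      then have "7 * (dist (x B) (e B) / 8) \<le> R" using meet[OF B] by (simp add: dist_commute)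
      moreover have "dist z y \<le> dist z (x B) + dist (x B) y" by (rule dist_triangle)
      moreover have "dist (x B) y \<le> dist (x B) (e B) + r / 2" using y by (simp add: T_def)
      \<comment> \<open>With \<open>D = dist (x B) (e B)\<close>, the bound is
        \<open>R + 9 * D / 8 + r / 2\<close>. Since \<open>r / 2 \<le> s < D / 8\<close> and
        \<open>7 * D / 8 \<le> R\<close>, it is below \<open>17 * R / 7\<close>.\<close>
      ultimately have "dist z y \<le> 3 * R" using meet[OF B] xe[OF B] r by linarith
      then show "y \<in> tube_boundary E r \<inter> cball z (3 * R)" using y by (simp add: T_def)
    qed
    have count: "real (card F) \<le> C * (H / s) ^ ?d"
      if F: "finite F" "F \<subseteq> J" and "H \<ge> 0"
        and near: "\<And>B. B \<in> F \<Longrightarrow> dist p (x B) + dist (x B) (e B) / 8 \<le> H" for F H p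
    proof -
      have "\<exists>x \<rho>. B = cball x \<rho> \<and> s \<le> \<rho> \<and> B \<subseteq> cball p H" if "B \<in> F" for B
      proof (intro exI conjI)
        have BJ: "B \<in> J" using that F by blast
        show "B = cball (x B) (dist (x B) (e B) / 8)" using ball[OF BJ] .
        show "s \<le> dist (x B) (e B) / 8" using xe[OF BJ] by simp
        have "cball (x B) (dist (x B) (e B) / 8) \<subseteq> cball p H"
          using near[OF that] by (simp add: cball_subset_cball_iff dist_commute)
        then show "B \<subseteq> cball p H" using ball[OF BJ] by simp
      qed
      then show ?thesis
        using card_whitney_balls_le[OF W _ F(1) _ s \<open>H \<ge> 0\<close>, of p] F JW assms by auto
    qed
    \<comment> \<open>All balls of \<open>J\<close> lie in \<open>cball z (R + 4 * s)\<close>, which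
      bounds the size of every finite subset of \<open>J\<close>.\<close>
    have finJ: "finite J"
    proof -
      have "card F \<le> nat \<lceil>C * ((R + 4 * s) / s) ^ ?d\<rceil>" if "finite F" "F \<subseteq> J" for F
      proof -
        have "real (card F) \<le> C * ((R + 4 * s) / s) ^ ?d"
        proof (rule count[OF that])
          fix B assume "B \<in> F"
          then have "B \<in> J" using that by blast
          from meet[OF this] xe[OF this]
          show "dist z (x B) + dist (x B) (e B) / 8 \<le> R + 4 * s" by simp
        qed (use R s in simp)
        then show ?thesis by linarith
      qed
      then show ?thesis using finite_if_finite_subsets_card_bdd by metis
    qed
    have "ennreal (c * r ^ (?d - 1)) * of_nat (card J)
        \<le> (\<Sum>i. if U i = {} then 0 else ennreal (diameter (U i) ^ (?d - 1)))"
      if U: "tube_boundary E r \<inter> cball z (3 * R) \<subseteq> (\<Union>i. U i)"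
        "\<And>i. bounded (U i)" "\<And>i. diameter (U i) \<le> r" for U :: "nat \<Rightarrow> (real ^ 'n) set"
    proof -
      let ?D = "\<lambda>i. ennreal (diameter (U i) ^ (?d - 1))"
      have loc: "ennreal (r ^ (?d - 1) / (17 * 4 ^ ?d)) \<le> (\<Sum>i. if U i \<inter> T B = {} then 0 else ?D i)"
        if B: "B \<in> J" for B
      proof (rule tube_boundary_cover_local[OF e[OF B] r0, unfolded dim])
        show "tube_boundary E r \<inter> cball (x B) (dist (x B) (e B) + r / 2) \<subseteq> T B"
          by (simp add: T_def)
        show "T B \<subseteq> (\<Union>i. U i)" using T3[OF B] U(1) by (rule subset_trans)
      \<comment> \<open>From \<open>s < r \<le> 2 * s\<close> and the radius bounds,
        \<open>dist (x B) (e B)\<close> lies between \<open>4 * r\<close> and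
        \<open>16 * r\<close>.\<close>
      qed (use U xe[OF B] r in auto)
      have few: "(\<Sum>B\<in>J. if U i \<inter> T B = {} then 0 else ?D i)
          \<le> ennreal N * (if U i = {} then 0 else ?D i)" for i
      proof (cases "U i = {}")
        case False
        then obtain p where p: "p \<in> U i" by auto
        let ?F = "{B \<in> J. U i \<inter> T B \<noteq> {}}"
        have "real (card ?F) \<le> C * (22 * s / s) ^ ?d"
        proof (rule count)
          fix B assume "B \<in> ?F"
          then obtain y where B: "B \<in> J" and y: "y \<in> U i" "y \<in> T B" by auto
          have "dist p y \<le> r"
            using diameter_bounded_bound[OF U(2) p y(1)] U(3)[of i] by simp
          moreover have "dist (x B) y \<le> dist (x B) (e B) + r / 2" using y by (simp add: T_def)
          ultimately have "dist p (x B) \<le> dist (x B) (e B) + r / 2 + r"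
            using dist_triangle[of p "x B" y] by (simp add: dist_commute)
          \<comment> \<open>The terms are at most \<open>16 * s\<close>, \<open>3 * s\<close> and
            \<open>2 * s\<close>, which fit into \<open>22 * s\<close>.\<close>
          then show "dist p (x B) + dist (x B) (e B) / 8 \<le> 22 * s"
            using xe[OF B] r by linarith
        qed (use finJ s in auto)
        then have "real (card ?F) \<le> N" using s by (simp add: N_def)
        then have "ennreal (real (card ?F)) * ?D i \<le> ennreal N * ?D i"
          by (intro mult_right_mono ennreal_leI) auto
        moreover have "(\<Sum>B\<in>J. if U i \<inter> T B = {} then 0 else ?D i) = (\<Sum>B\<in>?F. ?D i)"
          using finJ by (intro sum.mono_neutral_cong_right) auto
        ultimately show ?thesis using False by (simp add: ennreal_of_nat_eq_real_of_nat)
      qed simp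
      \<comment> \<open>Double counting of pairs of a ball and a covering set, with both sides
        multiplied by \<open>N\<close> to avoid division in \<open>ennreal\<close>.\<close>
      have "ennreal N * (ennreal (c * r ^ (?d - 1)) * of_nat (card J))
          = (\<Sum>B\<in>J. ennreal (r ^ (?d - 1) / (17 * 4 ^ ?d)))"
      proof -
        have "ennreal N * ennreal (c * r ^ (?d - 1)) = ennreal (N * (c * r ^ (?d - 1)))"
          using N c r0 by (intro ennreal_mult[symmetric]) auto
        also have "N * (c * r ^ (?d - 1)) = r ^ (?d - 1) / (17 * 4 ^ ?d)"
          using N by (simp add: c_def)
        finally show ?thesis by (simp only: mult.assoc[symmetric] sum_constant) (simp only: mult.commute)
      qed
      also have "\<dots> \<le> (\<Sum>B\<in>J. \<Sum>i. if U i \<inter> T B = {} then 0 else ?D i)"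
        using loc by (rule sum_mono)
      also have "\<dots> = (\<Sum>i. \<Sum>B\<in>J. if U i \<inter> T B = {} then 0 else ?D i)"
        by (rule suminf_sum[symmetric]) auto
      also have "\<dots> \<le> (\<Sum>i. ennreal N * (if U i = {} then 0 else ?D i))"
        using few by (intro suminf_le) auto
      also have "\<dots> = ennreal N * (\<Sum>i. if U i = {} then 0 else ?D i)" by simp
      finally show ?thesis using N by (simp add: ennreal_mult_le_mult_iff)
    qed
    \<comment> \<open>The single scale \<open>r\<close> suffices, because the measure is a supremum
      over all scales.\<close>
    then have "ennreal (c * r ^ (?d - 1)) * of_nat (card J)
        \<le> hausdorff_content (?d - 1) r (tube_boundary E r \<inter> cball z (3 * R))"
      unfolding hausdorff_content_def by (intro INF_greatest) auto
    also have "\<dots> \<le> hausdorff_measure (?d - 1) (tube_boundary E r \<inter> cball z (3 * R))"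
      unfolding hausdorff_measure_def using r0 by (intro SUP_upper) auto
    finally show ?thesis using finJ by (simp add: ecard_def J_def)
  qed
  then show ?thesis using c by blast
qed

end
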